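(* Let $M$ be an isometrically immersed submanifold of a metallic Riemannian manifold $(\bar M,J,g)$ with $J^2=pJ+qI$. Then $M$ is slant if and only if there exists a real number $\lambda\in[0,1]$ such that $$T^2=\lambda\,(pT+qI_{\Gamma(TM)}).$$
   Context: A metallic Riemannian manifold $(\bar M,J,g)$ is a smooth manifold with a $(1,1)$-tensor field $J$ satisfying $J^2=pJ+qI$ for some positive integers $p,q$ and a Riemannian metric $g$ with $g(JX,Y)=g(X,JY)$ for all vector fields $X,Y$. For $X\in\Gamma(TM)$, $TX:=(JX)^T$ is the component of $JX$ tangent to $M$; $I_{\Gamma(TM)}$ is the identity operator. $M$ is slant if for all $x\in M$ and nonzero $X_x\in T_xM$ the angle $\theta(X_x)\in[0,\pi/2]$ between $JX_x$ and $T_xM$ is a constant $\theta$ (independent of $x$ and $X_x$), called the slant angle; one has $\cos\theta(X_x)=\|TX_x\|/\|JX_x\|$. *)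

theory Defs
  imports "HOL-Analysis.Analysis" "HOL-Library.Function_Algebras"
begin

text \<open>Pointwise vector space structure on functions, used both for tangent vectors (families of
  coordinate vectors) and for vector fields.\<close>

instantiation "fun" :: (type, real_vector) real_vector
begin

definition scaleR_fun :: "real \<Rightarrow> ('a \<Rightarrow> 'b) \<Rightarrow> 'a \<Rightarrow> 'b"
  where "scaleR_fun r f = (\<lambda>x. r *\<^sub>R f x)"

instance
  by standard (simp_all add: scaleR_fun_def fun_eq_iff scaleR_add_right scaleR_add_left)

end

subsection \<open>Smooth maps between Euclidean spaces\<close>

text \<open>Only meant for open \<open>S\<close>: the derivatives are taken at interior points.\<close>

primrec Ck_on :: "nat \<Rightarrow> 'a::euclidean_space set \<Rightarrow> ('a \<Rightarrow> 'b::real_normed_vector) \<Rightarrow> bool" where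
  "Ck_on 0 S f \<longleftrightarrow> continuous_on S f"
| "Ck_on (Suc k) S f \<longleftrightarrow>
     f differentiable_on S \<and> (\<forall>v. Ck_on k S (\<lambda>x. frechet_derivative f (at x) v))"

definition smooth_on :: "'a::euclidean_space set \<Rightarrow> ('a \<Rightarrow> 'b::real_normed_vector) \<Rightarrow> bool"
  where "smooth_on S f \<longleftrightarrow> (\<forall>k. Ck_on k S f)"

subsection \<open>Smooth manifolds\<close>

text \<open>A chart is a pair of its domain and its coordinate map; the values of the coordinate map
  outside the domain are irrelevant. A manifold is given by a smooth (not necessarily maximal)
  atlas, and its set of points is the union of the chart domains, an open subset of a Hausdorff
  second countable space.\<close>

type_synonym ('m, 'e) chart = "'m set \<times> ('m \<Rightarrow> 'e)"

definition carrier :: "('m, 'e) chart set \<Rightarrow> 'm set"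
  where "carrier A = (\<Union>c\<in>A. fst c)"

definition chart_inv :: "('m, 'e) chart \<Rightarrow> 'e \<Rightarrow> 'm"
  where "chart_inv c = inv_into (fst c) (snd c)"

definition is_chart :: "('m::topological_space, 'e::euclidean_space) chart \<Rightarrow> bool"
  where "is_chart c \<longleftrightarrow> open (fst c) \<and> open (snd c ` fst c) \<and>
    homeomorphism (fst c) (snd c ` fst c) (snd c) (chart_inv c)"

definition transition :: "('m, 'e) chart \<Rightarrow> ('m, 'e) chart \<Rightarrow> 'e \<Rightarrow> 'e"
  where "transition c d = snd d \<circ> chart_inv c"

definition smooth_manifold ::
    "('m::{t2_space, second_countable_topology}, 'e::euclidean_space) chart set \<Rightarrow> bool"
  where "smooth_manifold A \<longleftrightarrow> (\<forall>c\<in>A. is_chart c) \<and>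
    (\<forall>c\<in>A. \<forall>d\<in>A. smooth_on (snd c ` (fst c \<inter> fst d)) (transition c d))"

definition charts_at :: "('m, 'e) chart set \<Rightarrow> 'm \<Rightarrow> ('m, 'e) chart set"
  where "charts_at A x = {c \<in> A. x \<in> fst c}"

text \<open>A tangent vector at \<open>x\<close> is a family of coordinate vectors, one for each chart
  around \<open>x\<close>, transforming by the derivatives of the transition maps. Charts not around \<open>x\<close>
  carry the dummy value 0; in particular the tangent space is \<open>{0}\<close> for \<open>x\<close> outside the
  carrier.\<close>

type_synonym ('m, 'e) tangent = "('m, 'e) chart \<Rightarrow> 'e"

definition tangent_space ::
    "('m, 'e::euclidean_space) chart set \<Rightarrow> 'm \<Rightarrow> ('m, 'e) tangent set"
  where "tangent_space A x = {v. (\<forall>c. c \<notin> charts_at A x \<longrightarrow> v c = 0) \<and>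
    (\<forall>c\<in>charts_at A x. \<forall>d\<in>charts_at A x.
       v d = frechet_derivative (transition c d) (at (snd c x)) (v c))}"

text \<open>The tangent vector at \<open>x\<close> whose coordinate vector in the chart \<open>c\<close> is \<open>u\<close>.\<close>

definition coord_vector ::
    "('m, 'e::euclidean_space) chart set \<Rightarrow> ('m, 'e) chart \<Rightarrow> 'm \<Rightarrow> 'e \<Rightarrow> ('m, 'e) tangent"
  where "coord_vector A c x u = (\<lambda>d. if d \<in> charts_at A x
    then frechet_derivative (transition c d) (at (snd c x)) u else 0)"

text \<open>The space of smooth vector fields; such a field is zero outside the carrier.\<close>

definition vector_fields ::
    "('m, 'e::euclidean_space) chart set \<Rightarrow> ('m \<Rightarrow> ('m, 'e) tangent) set"
  where "vector_fields A = {X. (\<forall>x. X x \<in> tangent_space A x) \<and>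
    (\<forall>c\<in>A. smooth_on (snd c ` fst c) (\<lambda>y. X (chart_inv c y) c))}"

subsection \<open>Riemannian metrics, endomorphism fields, metallic Riemannian manifolds\<close>

definition riemannian_metric ::
    "('m, 'e::euclidean_space) chart set
      \<Rightarrow> ('m \<Rightarrow> ('m, 'e) tangent \<Rightarrow> ('m, 'e) tangent \<Rightarrow> real) \<Rightarrow> bool"
  where "riemannian_metric A g \<longleftrightarrow>
    (\<forall>x\<in>carrier A. \<forall>u\<in>tangent_space A x. \<forall>v\<in>tangent_space A x. \<forall>w\<in>tangent_space A x. \<forall>a b.
       g x (a *\<^sub>R u + b *\<^sub>R v) w = a * g x u w + b * g x v w) \<and>
    (\<forall>x\<in>carrier A. \<forall>u\<in>tangent_space A x. \<forall>v\<in>tangent_space A x. g x u v = g x v u) \<and>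
    (\<forall>x\<in>carrier A. \<forall>v\<in>tangent_space A x. v \<noteq> 0 \<longrightarrow> g x v v > 0) \<and>
    (\<forall>c\<in>A. \<forall>u v. smooth_on (snd c ` fst c) (\<lambda>y. g (chart_inv c y)
       (coord_vector A c (chart_inv c y) u) (coord_vector A c (chart_inv c y) v)))"

text \<open>(1,1)-tensor fields, as smooth fields of endomorphisms of the tangent spaces.\<close>

definition endomorphism_field ::
    "('m, 'e::euclidean_space) chart set
      \<Rightarrow> ('m \<Rightarrow> ('m, 'e) tangent \<Rightarrow> ('m, 'e) tangent) \<Rightarrow> bool"
  where "endomorphism_field A J \<longleftrightarrow>
    (\<forall>x\<in>carrier A. \<forall>v\<in>tangent_space A x. J x v \<in> tangent_space A x) \<and>
    (\<forall>x\<in>carrier A. \<forall>v\<in>tangent_space A x. \<forall>w\<in>tangent_space A x. \<forall>a b.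
       J x (a *\<^sub>R v + b *\<^sub>R w) = a *\<^sub>R J x v + b *\<^sub>R J x w) \<and>
    (\<forall>c\<in>A. \<forall>u. smooth_on (snd c ` fst c)
       (\<lambda>y. J (chart_inv c y) (coord_vector A c (chart_inv c y) u) c))"

definition metallic_riemannian ::
    "('m::{t2_space, second_countable_topology}, 'e::euclidean_space) chart set
      \<Rightarrow> ('m \<Rightarrow> ('m, 'e) tangent \<Rightarrow> ('m, 'e) tangent)
      \<Rightarrow> ('m \<Rightarrow> ('m, 'e) tangent \<Rightarrow> ('m, 'e) tangent \<Rightarrow> real) \<Rightarrow> nat \<Rightarrow> nat \<Rightarrow> bool"
  where "metallic_riemannian A J g p q \<longleftrightarrow>
    smooth_manifold A \<and> riemannian_metric A g \<and> endomorphism_field A J \<and> p > 0 \<and> q > 0 \<and>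
    (\<forall>x\<in>carrier A. \<forall>v\<in>tangent_space A x. J x (J x v) = real p *\<^sub>R J x v + real q *\<^sub>R v) \<and>
    (\<forall>X\<in>vector_fields A. \<forall>Y\<in>vector_fields A. \<forall>x\<in>carrier A.
       g x (J x (X x)) (Y x) = g x (X x) (J x (Y x)))"

subsection \<open>Isometric immersions\<close>

definition smooth_map ::
    "('m::topological_space, 'e::euclidean_space) chart set
      \<Rightarrow> ('n::topological_space, 'f::euclidean_space) chart set \<Rightarrow> ('m \<Rightarrow> 'n) \<Rightarrow> bool"
  where "smooth_map A B f \<longleftrightarrow> f ` carrier A \<subseteq> carrier B \<and> continuous_on (carrier A) f \<and>
    (\<forall>c\<in>A. \<forall>d\<in>B. smooth_on (snd c ` (fst c \<inter> f -` fst d)) (snd d \<circ> f \<circ> chart_inv c))"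

text \<open>By the chain rule the choice of the chart \<open>c\<close> around \<open>x\<close> does not matter.\<close>

definition differential ::
    "('m, 'e::euclidean_space) chart set \<Rightarrow> ('n, 'f::euclidean_space) chart set
      \<Rightarrow> ('m \<Rightarrow> 'n) \<Rightarrow> 'm \<Rightarrow> ('m, 'e) tangent \<Rightarrow> ('n, 'f) tangent"
  where "differential A B f x v = (let c = (SOME c. c \<in> charts_at A x) in
    (\<lambda>d. if d \<in> charts_at B (f x)
      then frechet_derivative (snd d \<circ> f \<circ> chart_inv c) (at (snd c x)) (v c) else 0))"

definition immersion ::
    "('m::topological_space, 'e::euclidean_space) chart set
      \<Rightarrow> ('n::topological_space, 'f::euclidean_space) chart set \<Rightarrow> ('m \<Rightarrow> 'n) \<Rightarrow> bool"
  where "immersion A B f \<longleftrightarrow> smooth_map A B f \<and>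
    (\<forall>x\<in>carrier A. inj_on (differential A B f x) (tangent_space A x))"

definition isometric_immersion ::
    "('m::topological_space, 'e::euclidean_space) chart set
      \<Rightarrow> ('m \<Rightarrow> ('m, 'e) tangent \<Rightarrow> ('m, 'e) tangent \<Rightarrow> real)
      \<Rightarrow> ('n::topological_space, 'f::euclidean_space) chart set
      \<Rightarrow> ('n \<Rightarrow> ('n, 'f) tangent \<Rightarrow> ('n, 'f) tangent \<Rightarrow> real) \<Rightarrow> ('m \<Rightarrow> 'n) \<Rightarrow> bool"
  where "isometric_immersion A h B g f \<longleftrightarrow> immersion A B f \<and>
    (\<forall>x\<in>carrier A. \<forall>v\<in>tangent_space A x. \<forall>w\<in>tangent_space A x.
       h x v w = g (f x) (differential A B f x v) (differential A B f x w))"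

subsection \<open>The tangential part of the metallic structure, and slant submanifolds\<close>

text \<open>The component of the ambient vector \<open>z\<close> at \<open>f x\<close> tangent to the immersed manifold, that
  is, its orthogonal projection to the image of the differential, regarded as a tangent vector
  of the immersed manifold itself.\<close>

definition tangential ::
    "('m, 'e::euclidean_space) chart set \<Rightarrow> ('n, 'f::euclidean_space) chart set
      \<Rightarrow> ('n \<Rightarrow> ('n, 'f) tangent \<Rightarrow> ('n, 'f) tangent \<Rightarrow> real) \<Rightarrow> ('m \<Rightarrow> 'n)
      \<Rightarrow> 'm \<Rightarrow> ('n, 'f) tangent \<Rightarrow> ('m, 'e) tangent"
  where "tangential A B g f x z = (THE w. w \<in> tangent_space A x \<and>
    (\<forall>u\<in>tangent_space A x.
       g (f x) (z - differential A B f x w) (differential A B f x u) = 0))"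

text \<open>The operator \<open>T X = (J X)\<^sup>T\<close> on vector fields of the immersed manifold.\<close>

definition T_op ::
    "('m, 'e::euclidean_space) chart set \<Rightarrow> ('n, 'f::euclidean_space) chart set
      \<Rightarrow> ('n \<Rightarrow> ('n, 'f) tangent \<Rightarrow> ('n, 'f) tangent)
      \<Rightarrow> ('n \<Rightarrow> ('n, 'f) tangent \<Rightarrow> ('n, 'f) tangent \<Rightarrow> real) \<Rightarrow> ('m \<Rightarrow> 'n)
      \<Rightarrow> ('m \<Rightarrow> ('m, 'e) tangent) \<Rightarrow> 'm \<Rightarrow> ('m, 'e) tangent"
  where "T_op A B J g f X = (\<lambda>x. if x \<in> carrier A
    then tangential A B g f x (J (f x) (differential A B f x (X x))) else 0)"

definition vec_angle :: "('v \<Rightarrow> 'v \<Rightarrow> real) \<Rightarrow> 'v \<Rightarrow> 'v \<Rightarrow> real"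
  where "vec_angle b v w = arccos (b v w / (sqrt (b v v) * sqrt (b w w)))"

text \<open>The angle between a vector and a subspace is the smallest angle between the vector and a
  nonzero vector of the subspace.\<close>

definition angle_to :: "('v \<Rightarrow> 'v \<Rightarrow> real) \<Rightarrow> 'v::zero \<Rightarrow> 'v set \<Rightarrow> real"
  where "angle_to b v W = (INF w\<in>W - {0}. vec_angle b v w)"

definition slant ::
    "('m, 'e::euclidean_space) chart set \<Rightarrow> ('n, 'f::euclidean_space) chart set
      \<Rightarrow> ('n \<Rightarrow> ('n, 'f) tangent \<Rightarrow> ('n, 'f) tangent)
      \<Rightarrow> ('n \<Rightarrow> ('n, 'f) tangent \<Rightarrow> ('n, 'f) tangent \<Rightarrow> real) \<Rightarrow> ('m \<Rightarrow> 'n) \<Rightarrow> bool"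
  where "slant A B J g f \<longleftrightarrow> (\<exists>\<theta>\<in>{0..pi / 2}. \<forall>x\<in>carrier A. \<forall>v\<in>tangent_space A x. v \<noteq> 0 \<longrightarrow>
    angle_to (g (f x)) (J (f x) (differential A B f x v))
      (differential A B f x ` tangent_space A x) = \<theta>)"

end

theory Submission
  imports Defs
begin

text \<open>
  Everything happens in a single tangent space. Write \<open>D\<close> for the differential of the immersion at a
  point, \<open>b\<close> for the ambient inner product and \<open>t v\<close> for the tangential part of \<open>J (D v)\<close>.
  The angle between a vector and a subspace is the angle between the vector and its orthogonal
  projection, so the cosine of the slant angle is \<open>\<parallel>t v\<parallel> / \<parallel>J (D v)\<parallel>\<close>, and being slant
  means that \<open>\<parallel>t v\<parallel>\<^sup>2 = l \<parallel>J (D v)\<parallel>\<^sup>2\<close> for all \<open>v\<close> at all points, with one constant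
  \<open>l = cos\<^sup>2 \<theta>\<close> (\<open>slant_iff_norm_ratio\<close>).

  Both sides of this equation are quadratic forms. Since \<open>J\<close> is self-adjoint, so is \<open>t\<close>, and the
  symmetric bilinear form of the left-hand side is \<open>\<langle>t (t v), u\<rangle>\<close>; by \<open>J\<^sup>2 = p J + q I\<close> the one
  of the right-hand side is \<open>l \<langle>J (J v), u\<rangle> = l \<langle>p t v + q v, u\<rangle>\<close>. Polarization and
  nondegeneracy turn the equality of the forms into \<open>t\<^sup>2 = l (p t + q I)\<close>
  (\<open>t_square_iff\<close>).

  It remains to pass between vector fields and tangent vectors. The operator identity is
  an identity of fields, and the self-adjointness of \<open>J\<close> is given for smooth fields only; both
  are turned into pointwise statements because every tangent vector is the value of a smooth global
  field (\<open>tangent_vector_extends\<close>): its constant extension in a chart is multiplied by a bump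
  function with compact support in the chart domain. The support is closed because the manifold is
  Hausdorff, so the extension by zero is smooth. This rests on the closure of \<open>C\<^sup>k\<close> maps under products
  and composition, and on the flatness of \<open>exp (-1/s)\<close> at 0.
\<close>

section \<open>Calculus of \<open>C\<^sup>k\<close> maps\<close>

lemma frechet_derivative_cong_open:
  assumes "open S" "x \<in> S" "\<And>y. y \<in> S \<Longrightarrow> f y = g y"
  shows "frechet_derivative f (at x) = frechet_derivative g (at x)"
proof -
  have "(f has_derivative f') (at x) \<longleftrightarrow> (g has_derivative f') (at x)" for f'
    using has_derivative_transform_within_open[OF _ assms(1,2), of f f' UNIV g]
      has_derivative_transform_within_open[OF _ assms(1,2), of g f' UNIV f] assms(3) by auto
  then show ?thesis
    unfolding frechet_derivative_def by simp
qed

lemma frechet_derivative_eqI: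
  "(f has_derivative f') (at x) \<Longrightarrow> frechet_derivative f (at x) = f'"
  by (metis frechet_derivative_at)

lemma differentiable_on_open_derivative:
  assumes "f differentiable_on S" "open S" "x \<in> S"
  shows "(f has_derivative frechet_derivative f (at x)) (at x)"
  using assms by (simp add: differentiable_on_eq_differentiable_at flip: frechet_derivative_works)

lemma Ck_on_cong:
  assumes "open S" "Ck_on k S f" "\<And>x. x \<in> S \<Longrightarrow> f x = g x"
  shows "Ck_on k S g"
  using assms(2,3)
proof (induction k arbitrary: f g)
  case 0
  then show ?case by (simp cong: continuous_on_cong)
next
  case (Suc k)
  have "(g has_derivative frechet_derivative f (at x)) (at x)" if "x \<in> S" for x
    by (rule has_derivative_transform_within_open[OF
          differentiable_on_open_derivative[OF _ \<open>open S\<close> that] \<open>open S\<close> that])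
       (use Suc.prems in auto)
  then have "g differentiable_on S"
    using \<open>open S\<close> by (auto simp: differentiable_on_eq_differentiable_at differentiable_def)
  moreover have "Ck_on k S (\<lambda>x. frechet_derivative g (at x) v)" for v
    by (rule Suc.IH[of "\<lambda>x. frechet_derivative f (at x) v"])
       (use Suc.prems frechet_derivative_cong_open[OF \<open>open S\<close>, of _ f g] in auto)
  ultimately show ?case by simp
qed

text \<open>
  Lets a concrete formula for the derivative replace the Frechet derivative chosen in the
  definition of \<open>Ck_on\<close>.
\<close>

lemma Ck_on_Suc_derivativeI:
  assumes "open S" "\<And>x. x \<in> S \<Longrightarrow> (f has_derivative f' x) (at x)"
    and "\<And>v. Ck_on k S (\<lambda>x. f' x v)"
  shows "Ck_on (Suc k) S f"
proof -
  have "Ck_on k S (\<lambda>x. frechet_derivative f (at x) v)" for v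
    by (rule Ck_on_cong[OF assms(1) assms(3)[of v]]) (simp add: frechet_derivative_eqI[OF assms(2)])
  then show ?thesis
    using assms(1,2) by (auto simp: differentiable_on_eq_differentiable_at differentiable_def)
qed

lemma Ck_on_Un:
  assumes "open S" "open T" "Ck_on k S f" "Ck_on k T f"
  shows "Ck_on k (S \<union> T) f"
  using assms(3,4)
  by (induction k arbitrary: f)
     (use assms(1,2) in \<open>auto simp: differentiable_on_eq_differentiable_at open_Un intro: continuous_on_open_Un\<close>)

lemma Ck_on_pred: "Ck_on (Suc k) S f \<Longrightarrow> Ck_on k S f"
  by (induction k arbitrary: f) (auto intro: differentiable_imp_continuous_on)

lemma Ck_on_const [simp]: "Ck_on k S (\<lambda>x. c)"
  by (induction k arbitrary: c) auto

lemma Ck_on_id: "open S \<Longrightarrow> Ck_on k S (\<lambda>x. x)"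
  by (cases k) (auto intro!: Ck_on_Suc_derivativeI has_derivative_ident continuous_on_id)

lemma Ck_on_add:
  assumes "open S" "Ck_on k S f" "Ck_on k S g"
  shows "Ck_on k S (\<lambda>x. f x + g x)"
  using assms(2,3)
proof (induction k arbitrary: f g)
  case 0
  then show ?case by (simp add: continuous_on_add)
next
  case (Suc k)
  then have d: "f differentiable_on S" "g differentiable_on S"
    by simp_all
  have "Ck_on k S (\<lambda>x. frechet_derivative f (at x) v + frechet_derivative g (at x) v)" for v
    by (intro Suc.IH) (use Suc.prems in auto)
  then show ?case
    by (rule Ck_on_Suc_derivativeI[OF \<open>open S\<close> has_derivative_add, rotated -1])
       (auto intro: differentiable_on_open_derivative d \<open>open S\<close>)
qed

lemma Ck_on_sum:
  assumes "open S" "\<And>i. i \<in> I \<Longrightarrow> Ck_on k S (f i)"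
  shows "Ck_on k S (\<lambda>x. \<Sum>i\<in>I. f i x)"
  using assms(2)
  by (induction I rule: infinite_finite_induct) (auto intro: Ck_on_add[OF \<open>open S\<close>])

lemma (in bounded_bilinear) Ck_on_bilinear:
  assumes "open S" "Ck_on k S f" "Ck_on k S g"
  shows "Ck_on k S (\<lambda>x. prod (f x) (g x))"
  using assms(2,3)
proof (induction k arbitrary: f g)
  case 0
  then show ?case by (simp add: continuous_on)
next
  case (Suc k)
  then have d: "f differentiable_on S" "g differentiable_on S"
    by simp_all
  have "Ck_on k S (\<lambda>x. prod (f x) (frechet_derivative g (at x) v) +
      prod (frechet_derivative f (at x) v) (g x))" for v
    by (intro Ck_on_add[OF \<open>open S\<close>] Suc.IH) (use Suc.prems in \<open>auto intro: Ck_on_pred simp del: Ck_on.simps(2), auto\<close>)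
  then show ?case
    by (rule Ck_on_Suc_derivativeI[OF \<open>open S\<close> FDERIV, rotated -1])
       (auto intro: differentiable_on_open_derivative d \<open>open S\<close>)
qed

lemmas Ck_on_scaleR = bounded_bilinear.Ck_on_bilinear[OF bounded_bilinear_scaleR]
lemmas Ck_on_mult = bounded_bilinear.Ck_on_bilinear[OF bounded_bilinear_mult]
lemmas Ck_on_inner = bounded_bilinear.Ck_on_bilinear[OF bounded_bilinear_inner]

text \<open>
  In the chain rule the derivative of \<open>g\<close> is applied to a vector that varies with \<open>x\<close>. Expanding
  that vector in the standard basis gives a sum of products of \<open>C\<^sup>k\<close> functions, each of them
  a component of the derivative of \<open>f\<close> times the composition of \<open>f\<close> with a directional derivative of
  \<open>g\<close>, to which the induction hypothesis applies.
\<close>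

lemma Ck_on_compose:
  fixes f :: "'a::euclidean_space \<Rightarrow> 'b::euclidean_space" and g :: "'b \<Rightarrow> 'c::real_normed_vector"
  assumes "open S" "open T" "f ` S \<subseteq> T" "Ck_on k S f" "Ck_on k T g"
  shows "Ck_on k S (\<lambda>x. g (f x))"
  using assms(4,5)
proof (induction k arbitrary: g)
  case 0
  then show ?case using assms(3) continuous_on_compose2[of T g S f] by simp
next
  case (Suc k)
  let ?D = "frechet_derivative"
  have d: "f differentiable_on S" "g differentiable_on T"
    using Suc.prems by simp_all
  have lin: "linear (?D g (at y))" if "y \<in> T" for y
    using differentiable_on_open_derivative[OF d(2) \<open>open T\<close> that] has_derivative_linear by blast
  have "Ck_on k S (\<lambda>x. \<Sum>i\<in>Basis. (?D f (at x) v \<bullet> i) *\<^sub>R ?D g (at (f x)) i)" for v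
    by (intro Ck_on_sum[OF \<open>open S\<close>] Ck_on_scaleR[OF \<open>open S\<close>] Ck_on_inner[OF \<open>open S\<close>] Ck_on_const
        Suc.IH Ck_on_pred[of k S f])
       (use Suc.prems in auto)
  moreover have "(\<Sum>i\<in>Basis. (?D f (at x) v \<bullet> i) *\<^sub>R ?D g (at (f x)) i) = ?D g (at (f x)) (?D f (at x) v)"
    if "x \<in> S" for x v
  proof -
    have "f x \<in> T" using that assms(3) by auto
    then interpret linear "?D g (at (f x))" by (rule lin)
    show ?thesis
      by (simp only: scaleR[symmetric] sum[symmetric] euclidean_representation)
  qed
  ultimately have "Ck_on k S (\<lambda>x. ?D g (at (f x)) (?D f (at x) v))" for v
    by (rule Ck_on_cong[OF \<open>open S\<close>])
  moreover have "((\<lambda>x. g (f x)) has_derivative (\<lambda>v. ?D g (at (f x)) (?D f (at x) v))) (at x)"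
    if "x \<in> S" for x
    using has_derivative_compose[OF differentiable_on_open_derivative[OF d(1) \<open>open S\<close> that]
        differentiable_on_open_derivative[OF d(2) \<open>open T\<close>, of "f x"]] that assms(3) by blast
  ultimately show ?case
    by (intro Ck_on_Suc_derivativeI[OF \<open>open S\<close>])
qed

section \<open>Bump functions\<close>

text \<open>
  The factor \<open>s\<^sup>-\<^sup>n\<close> makes the family closed under differentiation up to linear combinations, so
  smoothness of every member follows by one induction.
\<close>

definition flat_exp :: "nat \<Rightarrow> real \<Rightarrow> real"
  where "flat_exp n s = (if s > 0 then inverse s ^ n * exp (- inverse s) else 0)"

lemma flat_exp_tendsto_0: "(flat_exp n \<longlongrightarrow> 0) (at 0)"
proof -
  have "((\<lambda>s. inverse s ^ n / exp (inverse s)) \<longlongrightarrow> 0) (at_right (0::real))"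
    by (rule filterlim_compose[OF tendsto_power_div_exp_0 filterlim_inverse_at_top_right])
  then have "(flat_exp n \<longlongrightarrow> 0) (at_right 0)"
    by (rule Lim_transform_eventually)
       (auto simp: flat_exp_def eventually_at_filter exp_minus divide_inverse)
  moreover have "(flat_exp n \<longlongrightarrow> 0) (at_left 0)"
    by (rule Lim_transform_eventually[OF tendsto_const[of 0]])
       (auto simp: flat_exp_def eventually_at_filter)
  ultimately show ?thesis
    by (simp add: filterlim_split_at)
qed

text \<open>
  At 0 the difference quotient of \<open>flat_exp n\<close> is \<open>flat_exp (n + 1)\<close>, which tends to 0 because the
  exponential dominates every power.
\<close>

lemma flat_exp_has_derivative:
  "(flat_exp n has_real_derivative flat_exp (n + 2) s - real n * flat_exp (n + 1) s) (at s)"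
proof -
  consider "s > 0" | "s < 0" | "s = 0" by linarith
  then show ?thesis
  proof cases
    case 1
    have i: "(inverse has_real_derivative - (inverse s ^ 2)) (at s)"
      using DERIV_inverse[of s UNIV] 1 by (simp add: power2_eq_square)
    have "((\<lambda>s. inverse s ^ n * exp (- inverse s)) has_real_derivative
        (real n * - (inverse s ^ 2) * inverse s ^ (n - 1)) * exp (- inverse s) +
        exp (- inverse s) * (- (- (inverse s ^ 2))) * inverse s ^ n) (at s)"
      using i by (intro DERIV_mult DERIV_fun_exp DERIV_minus DERIV_power[OF i, THEN DERIV_cong]) simp_all
    then have "((\<lambda>s. inverse s ^ n * exp (- inverse s)) has_real_derivative
        flat_exp (n + 2) s - real n * flat_exp (n + 1) s) (at s)"
      using 1 by (cases n) (simp_all add: flat_exp_def algebra_simps power2_eq_square del: power_inverse)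
    then show ?thesis
      by (rule has_field_derivative_transform_within_open[of _ _ _ "{0<..}"])
         (use 1 in \<open>auto simp: flat_exp_def\<close>)
  next
    case 2
    have "((\<lambda>_. 0) has_real_derivative flat_exp (n + 2) s - real n * flat_exp (n + 1) s) (at s)"
      using 2 by (auto simp: flat_exp_def)
    then show ?thesis
      by (rule has_field_derivative_transform_within_open[of _ _ _ "{..<0}"])
         (use 2 in \<open>auto simp: flat_exp_def\<close>)
  next
    case 3
    have "(\<lambda>s. (flat_exp n s - flat_exp n 0) / (s - 0)) = flat_exp (n + 1)"
      by (auto simp: flat_exp_def fun_eq_iff divide_inverse)
    then show ?thesis
      using flat_exp_tendsto_0[of "n + 1"] 3
      by (simp add: has_field_derivative_iff flat_exp_def)
  qed
qed

lemma Ck_on_flat_exp: "Ck_on k UNIV (flat_exp n)"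
proof (induction k arbitrary: n)
  case 0
  show ?case
    by (simp add: continuous_at_imp_continuous_on DERIV_isCont[OF flat_exp_has_derivative])
next
  case (Suc k)
  have "Ck_on k UNIV (\<lambda>s. flat_exp (n + 2) s + (- real n) * flat_exp (n + 1) s)"
    by (intro Ck_on_add Ck_on_mult Ck_on_const Suc.IH open_UNIV)
  then have "Ck_on k UNIV (\<lambda>s. (flat_exp (n + 2) s - real n * flat_exp (n + 1) s) * v)" for v
    by (intro Ck_on_mult Ck_on_const open_UNIV) simp
  with flat_exp_has_derivative show ?case
    by (intro Ck_on_Suc_derivativeI[where f' = "\<lambda>s v. (flat_exp (n + 2) s - real n * flat_exp (n + 1) s) * v"])
       (auto simp: has_field_derivative_def)
qed

lemma bump_function:
  fixes a :: "'a::euclidean_space"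
  assumes "r > 0"
  obtains \<phi> :: "'a \<Rightarrow> real"
  where "\<phi> a = 1" "\<And>y. y \<notin> ball a r \<Longrightarrow> \<phi> y = 0" "\<And>k. Ck_on k UNIV \<phi>"
proof -
  \<comment> \<open>\<open>\<rho>\<close> is positive exactly on the ball, and \<open>\<rho> a = r\<^sup>2\<close>.\<close>
  define \<rho> where "\<rho> y = r\<^sup>2 + (- 1) * ((y + - a) \<bullet> (y + - a))" for y
  define \<phi> where "\<phi> y = exp (1 / r\<^sup>2) * flat_exp 0 (\<rho> y)" for y
  have "\<phi> a = 1"
    using assms by (simp add: \<phi>_def \<rho>_def flat_exp_def exp_minus divide_inverse)
  moreover have "\<phi> y = 0" if "y \<notin> ball a r" for y
  proof -
    have "r\<^sup>2 \<le> (norm (y - a))\<^sup>2"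
      using that assms by (intro power_mono) (auto simp: dist_norm norm_minus_commute)
    then show ?thesis
      by (simp add: \<phi>_def \<rho>_def flat_exp_def power2_norm_eq_inner)
  qed
  moreover have "Ck_on k UNIV \<phi>" for k
  proof -
    have "Ck_on k UNIV (\<lambda>y. y + - a)"
      by (intro Ck_on_add Ck_on_id Ck_on_const open_UNIV)
    then have "Ck_on k UNIV (\<lambda>y. (y + - a) \<bullet> (y + - a))"
      by (intro Ck_on_inner open_UNIV)
    then have "Ck_on k UNIV \<rho>"
      unfolding \<rho>_def by (intro Ck_on_add Ck_on_mult Ck_on_const open_UNIV)
    then have "Ck_on k UNIV (\<lambda>y. flat_exp 0 (\<rho> y))"
      by (rule Ck_on_compose[OF open_UNIV open_UNIV subset_UNIV _ Ck_on_flat_exp])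
    then show ?thesis
      unfolding \<phi>_def by (intro Ck_on_mult Ck_on_const open_UNIV)
  qed
  ultimately show ?thesis ..
qed

section \<open>Charts and tangent spaces\<close>

lemma chart_inv_chart: "is_chart c \<Longrightarrow> x \<in> fst c \<Longrightarrow> chart_inv c (snd c x) = x"
  unfolding is_chart_def homeomorphism_def by blast

lemma chart_inv_mem: "y \<in> snd c ` fst c \<Longrightarrow> chart_inv c y \<in> fst c"
  unfolding chart_inv_def by (rule inv_into_into)

lemma open_chart_image:
  assumes "is_chart c" "open U"
  shows "open (snd c ` (fst c \<inter> U))"
proof -
  have "openin (top_of_set (snd c ` fst c)) (snd c ` (fst c \<inter> U))"
    using assms homeomorphism_imp_open_map[of "fst c" "snd c ` fst c" "snd c" "chart_inv c"]
    by (auto simp: is_chart_def openin_open_Int)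
  then show ?thesis
    using assms openin_open_trans is_chart_def by blast
qed

lemma smooth_on_has_derivative:
  assumes "smooth_on S f" "open S" "x \<in> S"
  shows "(f has_derivative frechet_derivative f (at x)) (at x)"
  using assms by (intro differentiable_on_open_derivative)
    (auto simp: smooth_on_def dest!: spec[of _ "Suc 0"])

lemma frechet_derivative_chain_open:
  assumes "open S" "y \<in> S" and k: "\<And>z. z \<in> S \<Longrightarrow> k z = g (f z)"
    and "(f has_derivative frechet_derivative f (at y)) (at y)"
    and "(g has_derivative frechet_derivative g (at (f y))) (at (f y))"
  shows "frechet_derivative k (at y) u = frechet_derivative g (at (f y)) (frechet_derivative f (at y) u)"
proof -
  have "frechet_derivative k (at y) = frechet_derivative (\<lambda>z. g (f z)) (at y)"
    by (rule frechet_derivative_cong_open[OF assms(1,2) k])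
  also have "\<dots> = (\<lambda>u. frechet_derivative g (at (f y)) (frechet_derivative f (at y) u))"
    by (rule frechet_derivative_eqI[OF has_derivative_compose[OF assms(4,5)]])
  finally show ?thesis by simp
qed

lemma smooth_manifold_is_chart: "smooth_manifold A \<Longrightarrow> c \<in> A \<Longrightarrow> is_chart c"
  unfolding smooth_manifold_def by blast

lemma charts_atD: "c \<in> charts_at A x \<Longrightarrow> c \<in> A" "c \<in> charts_at A x \<Longrightarrow> x \<in> fst c"
  by (auto simp: charts_at_def)

lemma open_chart_overlap:
  "smooth_manifold A \<Longrightarrow> c \<in> A \<Longrightarrow> d \<in> A \<Longrightarrow> open (snd c ` (fst c \<inter> fst d))"
  using open_chart_image is_chart_def smooth_manifold_is_chart by blast

lemma transition_has_derivative:
  assumes "smooth_manifold A" "c \<in> charts_at A x" "d \<in> charts_at A x"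
  shows "(transition c d has_derivative frechet_derivative (transition c d) (at (snd c x))) (at (snd c x))"
  by (rule smooth_on_has_derivative[OF _ open_chart_overlap[of A c d]])
     (use assms in \<open>auto simp: smooth_manifold_def charts_at_def\<close>)

text \<open>
  The consistency condition behind the definition of tangent vectors: it makes every coordinate
  vector in one chart extend to a compatible family.
\<close>

lemma transition_cocycle:
  assumes "smooth_manifold A" "c \<in> charts_at A x" "d \<in> charts_at A x" "e \<in> charts_at A x"
  shows "frechet_derivative (transition c e) (at (snd c x)) u =
    frechet_derivative (transition d e) (at (snd d x)) (frechet_derivative (transition c d) (at (snd c x)) u)"
proof -
  have ch: "is_chart c" "is_chart d" and x: "x \<in> fst c" "x \<in> fst d" and A: "c \<in> A" "d \<in> A"
    using assms smooth_manifold_is_chart[OF assms(1)] by (auto simp: charts_at_def)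
  have eq: "transition c d (snd c x) = snd d x"
    using ch x by (simp add: transition_def chart_inv_chart)
  have "transition c e z = transition d e (transition c d z)" if "z \<in> snd c ` (fst c \<inter> fst d)" for z
    using that ch by (auto simp: transition_def chart_inv_chart)
  then show ?thesis
    using frechet_derivative_chain_open[OF open_chart_overlap[OF assms(1) A], of "snd c x"
        "transition c e" "transition d e" "transition c d" u] x
      transition_has_derivative[OF assms(1,2,3)] transition_has_derivative[OF assms(1,3,4)]
    by (simp add: eq)
qed

lemma coord_vector_tangent:
  "smooth_manifold A \<Longrightarrow> c \<in> charts_at A x \<Longrightarrow> coord_vector A c x u \<in> tangent_space A x"
  by (auto simp: tangent_space_def coord_vector_def intro: transition_cocycle)

lemma tangent_eq_coord_vector:
  assumes "v \<in> tangent_space A x" "c \<in> charts_at A x"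
  shows "v = coord_vector A c x (v c)"
proof
  fix d
  have "v d = frechet_derivative (transition c d) (at (snd c x)) (v c)" if "d \<in> charts_at A x"
    using assms that unfolding tangent_space_def by blast
  moreover have "v d = 0" if "d \<notin> charts_at A x"
    using assms(1) that unfolding tangent_space_def by blast
  ultimately show "v d = coord_vector A c x (v c) d"
    unfolding coord_vector_def by presburger
qed

lemma tangent_space_eq_range:
  "smooth_manifold A \<Longrightarrow> c \<in> charts_at A x \<Longrightarrow> tangent_space A x = range (coord_vector A c x)"
  by (intro subset_antisym subsetI) (auto intro: range_eqI[where f = "coord_vector A c x", OF tangent_eq_coord_vector] coord_vector_tangent)

lemma linear_coord_vector:
  assumes "smooth_manifold A" "c \<in> charts_at A x"
  shows "linear (coord_vector A c x)"
proof -
  have "linear (frechet_derivative (transition c d) (at (snd c x)))" if "d \<in> charts_at A x" for d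
    using transition_has_derivative[OF assms that] by (rule has_derivative_linear)
  then show ?thesis
    by (auto intro!: linearI simp: coord_vector_def fun_eq_iff scaleR_fun_def linear_add linear_scale)
qed

lemma subspace_tangent_space:
  assumes "smooth_manifold A" "x \<in> carrier A"
  shows "subspace (tangent_space A x)"
proof -
  obtain c where "c \<in> charts_at A x"
    using assms(2) by (auto simp: carrier_def charts_at_def)
  then show ?thesis
    using assms(1) by (simp add: tangent_space_eq_range linear_coord_vector linear_subspace_image)
qed

lemma tangent_space_outside: "x \<notin> carrier A \<Longrightarrow> v \<in> tangent_space A x \<Longrightarrow> v = 0"
  by (auto simp: tangent_space_def carrier_def charts_at_def fun_eq_iff)

section \<open>The differential of a smooth map\<close>

text \<open>
  Local representatives take arbitrary values outside this set; being open, it makes their Frechet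
  derivatives at its points independent of those values.
\<close>

lemma open_local_representative_domain:
  assumes "smooth_manifold A" "smooth_map A B f" "c \<in> A" "is_chart d"
  shows "open (snd c ` (fst c \<inter> f -` fst d))"
proof -
  have ch: "is_chart c"
    using assms(1,3) by (rule smooth_manifold_is_chart)
  have "continuous_on (fst c) f"
    using assms(2,3) continuous_on_subset[of "carrier A" f "fst c"]
    by (auto simp: smooth_map_def carrier_def)
  then have "open (fst c \<inter> f -` fst d)"
    using ch assms(4) by (auto simp: is_chart_def intro: continuous_open_preimage)
  then show ?thesis
    using open_chart_image[OF ch, of "fst c \<inter> f -` fst d"] by (simp add: Int_absorb1)
qed

lemma local_representative_has_derivative:
  assumes "smooth_manifold A" "smooth_manifold B" "smooth_map A B f"
    and "c \<in> charts_at A x" "d \<in> charts_at B (f x)"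
  shows "(snd d \<circ> f \<circ> chart_inv c has_derivative
    frechet_derivative (snd d \<circ> f \<circ> chart_inv c) (at (snd c x))) (at (snd c x))"
proof (rule smooth_on_has_derivative)
  show "smooth_on (snd c ` (fst c \<inter> f -` fst d)) (snd d \<circ> f \<circ> chart_inv c)"
    using assms(3-5) by (auto simp: smooth_map_def charts_at_def)
  show "open (snd c ` (fst c \<inter> f -` fst d))"
    by (rule open_local_representative_domain[OF assms(1,3) charts_atD(1)[OF assms(4)]
          smooth_manifold_is_chart[OF assms(2) charts_atD(1)[OF assms(5)]]])
  show "snd c x \<in> snd c ` (fst c \<inter> f -` fst d)"
    using assms(4,5) by (auto simp: charts_at_def)
qed

lemma some_chart_at: "x \<in> carrier A \<Longrightarrow> (SOME c. c \<in> charts_at A x) \<in> charts_at A x"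
  by (rule someI_ex) (auto simp: carrier_def charts_at_def)

lemma linear_differential:
  assumes "smooth_manifold A" "smooth_manifold B" "smooth_map A B f" "x \<in> carrier A"
  shows "linear (differential A B f x)"
proof -
  have "linear (frechet_derivative (snd d \<circ> f \<circ> chart_inv (SOME c. c \<in> charts_at A x))
      (at (snd (SOME c. c \<in> charts_at A x) x)))" if "d \<in> charts_at B (f x)" for d
    using local_representative_has_derivative[OF assms(1-3) some_chart_at[OF assms(4)] that]
    by (rule has_derivative_linear)
  then show ?thesis
    by (auto intro!: linearI simp: differential_def Let_def fun_eq_iff scaleR_fun_def linear_add linear_scale)
qed

text \<open>
  By the chain rule, changing the chart of the target multiplies the derivative of a local
  representative by the derivative of the transition map, which is the compatibility
  required of a tangent vector.
\<close>

lemma differential_tangent: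
  assumes "smooth_manifold A" "smooth_manifold B" "smooth_map A B f" "x \<in> carrier A"
  shows "differential A B f x v \<in> tangent_space B (f x)"
proof -
  define c where "c = (SOME c. c \<in> charts_at A x)"
  have c: "c \<in> charts_at A x"
    unfolding c_def by (rule some_chart_at[OF assms(4)])
  have "frechet_derivative (snd e \<circ> f \<circ> chart_inv c) (at (snd c x)) u =
      frechet_derivative (transition d e) (at (snd d (f x)))
       (frechet_derivative (snd d \<circ> f \<circ> chart_inv c) (at (snd c x)) u)"
    if d: "d \<in> charts_at B (f x)" and e: "e \<in> charts_at B (f x)" for d e u
  proof -
    have ch: "is_chart c" "is_chart d"
      using c d assms(1,2) smooth_manifold_is_chart charts_atD(1) by metis+
    have eq: "(snd d \<circ> f \<circ> chart_inv c) (snd c x) = snd d (f x)"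
      using c ch by (auto simp: charts_at_def chart_inv_chart)
    define S where "S = snd c ` (fst c \<inter> f -` fst d)"
    have S: "open S" "snd c x \<in> S"
      using open_local_representative_domain[OF assms(1,3) charts_atD(1)[OF c] ch(2)] c d
      by (auto simp: S_def charts_at_def)
    have "(snd e \<circ> f \<circ> chart_inv c) z = transition d e ((snd d \<circ> f \<circ> chart_inv c) z)" if "z \<in> S" for z
      using that ch by (auto simp: S_def transition_def chart_inv_chart)
    from frechet_derivative_chain_open[OF S, of "snd e \<circ> f \<circ> chart_inv c" "transition d e", OF this
        local_representative_has_derivative[OF assms(1-3) c d], unfolded eq]
    show ?thesis
      using transition_has_derivative[OF assms(2) d e] by simp
  qed
  note change_of_chart = this
  show ?thesis
    unfolding tangent_space_def differential_def Let_def c_def[symmetric] mem_Collect_eq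
  proof (intro conjI allI impI ballI)
    fix d e assume "d \<in> charts_at B (f x)" "e \<in> charts_at B (f x)"
    then show "(if e \<in> charts_at B (f x)
         then frechet_derivative (snd e \<circ> f \<circ> chart_inv c) (at (snd c x)) (v c) else 0) =
        frechet_derivative (transition d e) (at (snd d (f x)))
         (if d \<in> charts_at B (f x)
          then frechet_derivative (snd d \<circ> f \<circ> chart_inv c) (at (snd c x)) (v c) else 0)"
      by (simp only: if_True change_of_chart[of d e "v c"])
  qed simp
qed

section \<open>Extension of tangent vectors to vector fields\<close>

lemma Ck_on_transition_derivative:
  assumes "smooth_manifold A" "c \<in> A" "d \<in> A"
  shows "Ck_on k (snd d ` (fst c \<inter> fst d))
    (\<lambda>y. frechet_derivative (transition c d) (at (transition d c y)) u)"
proof -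
  let ?W = "snd c ` (fst c \<inter> fst d)" and ?W' = "snd d ` (fst d \<inter> fst c)"
  have ch: "is_chart c" "is_chart d"
    using assms smooth_manifold_is_chart by metis+
  have "smooth_on ?W (transition c d)" "smooth_on ?W' (transition d c)"
    using assms by (auto simp: smooth_manifold_def)
  then have "Ck_on k ?W (\<lambda>y. frechet_derivative (transition c d) (at y) u)" "Ck_on k ?W' (transition d c)"
    unfolding smooth_on_def by (metis Ck_on.simps(2), metis)
  moreover have "transition d c ` ?W' \<subseteq> ?W"
    using ch by (auto simp: transition_def chart_inv_chart)
  ultimately have "Ck_on k ?W' (\<lambda>y. frechet_derivative (transition c d) (at (transition d c y)) u)"
    using Ck_on_compose[OF open_chart_overlap[OF assms(1,3,2)] open_chart_overlap[OF assms]] by blast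
  then show ?thesis by (simp add: Int_commute)
qed

text \<open>
  A bump function in a chart cuts off the field with constant coordinates. Smoothness in another chart
  is checked on two open sets that cover its domain: the overlap, where the field is a product of
  smooth functions, and the complement of the compact support, where it vanishes.
\<close>

lemma tangent_vector_extends:
  assumes "smooth_manifold A" "x \<in> carrier A" "v \<in> tangent_space A x"
  obtains X where "X \<in> vector_fields A" "X x = v"
proof -
  obtain c where c: "c \<in> charts_at A x" "c \<in> A" "x \<in> fst c" and ch: "is_chart c"
    using assms(1,2) by (auto simp: carrier_def charts_at_def smooth_manifold_def)
  have "open (snd c ` fst c)"
    using ch by (simp add: is_chart_def)
  then obtain r where r: "r > 0" "cball (snd c x) r \<subseteq> snd c ` fst c"
    using c(3) open_contains_cball by blast
  from bump_function[OF r(1), of "snd c x"] obtain \<phi> :: "'b \<Rightarrow> real"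
    where \<phi>: "\<phi> (snd c x) = 1" "\<And>y. y \<notin> ball (snd c x) r \<Longrightarrow> \<phi> y = 0" "\<And>k. Ck_on k UNIV \<phi>"
    by metis
  define K where "K = chart_inv c ` cball (snd c x) r"
  have "homeomorphism (fst c) (snd c ` fst c) (snd c) (chart_inv c)"
    using ch by (simp add: is_chart_def)
  then have "continuous_on (snd c ` fst c) (chart_inv c)"
    by (simp add: homeomorphism_def)
  then have "compact K"
    unfolding K_def by (intro compact_continuous_image compact_cball continuous_on_subset[OF _ r(2)])
  then have "closed K" by (rule compact_imp_closed)
  have "K \<subseteq> fst c"
    using chart_inv_mem[OF subsetD[OF r(2)]] by (auto simp: K_def)
  have \<phi>0: "\<phi> (snd c z) = 0" if "z \<in> fst c" "z \<notin> K" for z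
  proof -
    have "z \<in> K" if "snd c z \<in> ball (snd c x) r"
      unfolding K_def
      by (rule image_eqI[of _ _ "snd c z"])
         (use that chart_inv_chart[OF ch \<open>z \<in> fst c\<close>] ball_subset_cball in auto)
    then have "snd c z \<notin> ball (snd c x) r"
      using that(2) by blast
    then show ?thesis by (rule \<phi>(2))
  qed
  define X where "X z = (if z \<in> fst c then \<phi> (snd c z) *\<^sub>R coord_vector A c z (v c) else 0)" for z
  have "X z \<in> tangent_space A z" for z
  proof (cases "z \<in> fst c")
    case True
    then have "c \<in> charts_at A z" "z \<in> carrier A"
      using c(2) by (auto simp: charts_at_def carrier_def)
    with True show ?thesis
      unfolding X_def using assms(1)
      by (simp add: subspace_scale[OF subspace_tangent_space] coord_vector_tangent)
  next
    case False
    have "0 \<in> tangent_space A z"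
    proof (cases "z \<in> carrier A")
      case True
      then show ?thesis using assms(1) by (simp add: subspace_0[OF subspace_tangent_space])
    next
      case False
      then show ?thesis by (auto simp: tangent_space_def carrier_def charts_at_def)
    qed
    with False show ?thesis by (simp add: X_def)
  qed
  moreover have "smooth_on (snd d ` fst d) (\<lambda>y. X (chart_inv d y) d)" if d: "d \<in> A" for d
    unfolding smooth_on_def
  proof
    fix k
    have chd: "is_chart d"
      using d assms(1) smooth_manifold_is_chart by blast
    let ?U = "snd d ` (fst d \<inter> fst c)" and ?V = "snd d ` (fst d \<inter> - K)"
    have op: "open ?U" "open ?V"
      using open_chart_overlap[OF assms(1) d c(2)] open_chart_image[OF chd, of "- K"] \<open>closed K\<close> by auto
    have "smooth_on ?U (transition d c)"
      using assms(1) c(2) d by (simp add: smooth_manifold_def)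
    then have "Ck_on k ?U (\<lambda>y. \<phi> (transition d c y))"
      unfolding smooth_on_def using Ck_on_compose[OF op(1) open_UNIV _ _ \<phi>(3)] by blast
    then have "Ck_on k ?U (\<lambda>y. \<phi> (transition d c y) *\<^sub>R
        frechet_derivative (transition c d) (at (transition d c y)) (v c))"
      using Ck_on_transition_derivative[OF assms(1) c(2) d]
      by (intro Ck_on_scaleR op) (simp_all add: Int_commute)
    then have "Ck_on k ?U (\<lambda>y. X (chart_inv d y) d)"
      by (rule Ck_on_cong[OF op(1)])
         (use d in \<open>auto simp: X_def chart_inv_chart[OF chd] coord_vector_def charts_at_def transition_def scaleR_fun_def\<close>)
    moreover have "Ck_on k ?V (\<lambda>y. X (chart_inv d y) d)"
      by (rule Ck_on_cong[OF op(2), of _ "\<lambda>_. 0"])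
         (auto simp: X_def chart_inv_chart[OF chd] \<phi>0 scaleR_fun_def)
    ultimately have "Ck_on k (?U \<union> ?V) (\<lambda>y. X (chart_inv d y) d)"
      by (intro Ck_on_Un op)
    moreover have "?U \<union> ?V = snd d ` fst d"
      using \<open>K \<subseteq> fst c\<close> by blast
    ultimately show "Ck_on k (snd d ` fst d) (\<lambda>y. X (chart_inv d y) d)"
      by simp
  qed
  ultimately have "X \<in> vector_fields A"
    by (simp add: vector_fields_def)
  moreover have "X x = v"
    using c \<phi>(1) tangent_eq_coord_vector[OF assms(3) c(1)] by (simp add: X_def)
  ultimately show thesis ..
qed

section \<open>Projections and angles in an inner product space\<close>

text \<open>
  Tangent spaces are subspaces of a function type, and a metric is an inner product
  on such a subspace only, hence the explicit carrier.
\<close>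

locale inner_product_on =
  fixes E :: "'v::real_vector set" and b :: "'v \<Rightarrow> 'v \<Rightarrow> real"
  assumes subspace: "subspace E"
    and linear_left: "u \<in> E \<Longrightarrow> v \<in> E \<Longrightarrow> w \<in> E \<Longrightarrow> b (r *\<^sub>R u + s *\<^sub>R v) w = r * b u w + s * b v w"
    and sym: "u \<in> E \<Longrightarrow> v \<in> E \<Longrightarrow> b u v = b v u"
    and pos: "v \<in> E \<Longrightarrow> v \<noteq> 0 \<Longrightarrow> b v v > 0"
begin

lemmas closed [simp] = subspace_0[OF subspace] subspace_add[OF subspace] subspace_scale[OF subspace]
  subspace_diff[OF subspace]

lemma add_left: "u \<in> E \<Longrightarrow> v \<in> E \<Longrightarrow> w \<in> E \<Longrightarrow> b (u + v) w = b u w + b v w"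
  using linear_left[of u v w 1 1] by simp

lemma scale_left: "u \<in> E \<Longrightarrow> w \<in> E \<Longrightarrow> b (r *\<^sub>R u) w = r * b u w"
  using linear_left[of u 0 w r 0] by simp

lemma diff_left: "u \<in> E \<Longrightarrow> v \<in> E \<Longrightarrow> w \<in> E \<Longrightarrow> b (u - v) w = b u w - b v w"
  using linear_left[of u v w 1 "-1"] by simp

lemma add_right: "u \<in> E \<Longrightarrow> v \<in> E \<Longrightarrow> w \<in> E \<Longrightarrow> b w (u + v) = b w u + b w v"
  by (metis add_left sym closed(2))

lemma scale_right: "u \<in> E \<Longrightarrow> w \<in> E \<Longrightarrow> b w (r *\<^sub>R u) = r * b w u"
  by (metis scale_left sym closed(3))

lemma diff_right: "u \<in> E \<Longrightarrow> v \<in> E \<Longrightarrow> w \<in> E \<Longrightarrow> b w (u - v) = b w u - b w v"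
  by (metis diff_left sym closed(4))

lemma zero_left [simp]: "w \<in> E \<Longrightarrow> b 0 w = 0"
  using scale_left[of 0 w 0] by simp

lemma nonneg: "v \<in> E \<Longrightarrow> b v v \<ge> 0"
  using pos[of v] by (cases "v = 0") auto

lemma eq_zero: "v \<in> E \<Longrightarrow> b v v = 0 \<Longrightarrow> v = 0"
  using pos[of v] by fastforce

lemma Cauchy_Schwarz:
  assumes "u \<in> E" "v \<in> E"
  shows "(b u v)\<^sup>2 \<le> b u u * b v v"
proof (cases "v = 0")
  case True
  then show ?thesis using assms sym[of u v] by simp
next
  case False
  define w where "w = b v v *\<^sub>R u - b u v *\<^sub>R v"
  have "b w w = b v v * (b u u * b v v - (b u v)\<^sup>2)"
    unfolding w_def using assms sym[of u v]
    by (simp add: diff_left diff_right scale_left scale_right power2_eq_square algebra_simps)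
  moreover have "b w w \<ge> 0"
    unfolding w_def using assms by (simp add: nonneg)
  ultimately show ?thesis
    using pos[OF assms(2) False] by (simp add: zero_le_mult_iff)
qed

lemma Cauchy_Schwarz_sqrt:
  assumes "u \<in> E" "v \<in> E"
  shows "\<bar>b u v\<bar> \<le> sqrt (b u u) * sqrt (b v v)"
  using real_sqrt_le_mono[OF Cauchy_Schwarz[OF assms]] by (simp add: real_sqrt_mult)

text \<open>
  Gram-Schmidt, one vector at a time: a new generator is replaced by its component \<open>n\<close> orthogonal to
  the previous span, and the projection changes by a multiple of \<open>n\<close>.
\<close>

lemma orthogonal_projection_exists:
  assumes "finite S" "S \<subseteq> E" "z \<in> E"
  shows "\<exists>w\<in>span S. \<forall>u\<in>span S. b (z - w) u = 0"
  using assms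
proof (induction S arbitrary: z rule: finite_induct)
  case empty
  have "b z 0 = 0" using empty sym[of z 0] by simp
  then show ?case by simp
next
  case (insert a S)
  have S: "span S \<subseteq> E"
    using insert.prems subspace by (simp add: span_minimal)
  obtain a' where a': "a' \<in> span S" "\<And>u. u \<in> span S \<Longrightarrow> b (a - a') u = 0"
    using insert.IH[of a] insert.prems by auto
  obtain z' where z': "z' \<in> span S" "\<And>u. u \<in> span S \<Longrightarrow> b (z - z') u = 0"
    using insert.IH[of z] insert.prems by auto
  define n where "n = a - a'"
  define r where "r = b (z - z') n / b n n"
  have E: "n \<in> E" "z \<in> E" "z' \<in> E"
    using a' z' S insert.prems by (auto simp: n_def)
  have n: "n \<in> span (insert a S)" and sub: "span S \<subseteq> span (insert a S)"
  proof -
    show sub: "span S \<subseteq> span (insert a S)"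
      by (rule span_mono) auto
    then show "n \<in> span (insert a S)"
      unfolding n_def using a'(1) by (intro span_diff) (auto intro: span_base)
  qed
  \<comment> \<open>If \<open>b n n = 0\<close> then \<open>n = 0\<close> and \<open>r = 0\<close> by division by zero, and both sides vanish.\<close>
  have rn: "r * b n n = b (z - z') n"
    using E eq_zero[of n] sym[of "z - z'" 0] by (cases "b n n = 0") (auto simp: r_def)
  have "b (z - (z' + r *\<^sub>R n)) u = 0" if u: "u \<in> span (insert a S)" for u
  proof -
    obtain k where k: "u - k *\<^sub>R a \<in> span S"
      using u span_breakdown_eq by blast
    define s where "s = (u - k *\<^sub>R a) + k *\<^sub>R a'"
    have s: "s \<in> span S"
      unfolding s_def using k a'(1) by (intro span_add span_scale)
    have "u = s + k *\<^sub>R n"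
      by (simp add: s_def n_def scaleR_diff_right)
    moreover have "b (z - z' - r *\<^sub>R n) s = 0"
      using s S E z'(2) a'(2)[of s] by (simp add: diff_left scale_left n_def[symmetric] subsetD)
    moreover have "b (z - z' - r *\<^sub>R n) n = 0"
      using E rn by (simp add: diff_left scale_left)
    ultimately show ?thesis
      using s S E by (simp add: add_right scale_right subsetD diff_diff_add[symmetric])
  qed
  moreover have "z' + r *\<^sub>R n \<in> span (insert a S)"
    using n sub z'(1) by (intro span_add span_scale) auto
  ultimately show ?case by blast
qed

text \<open>
  For \<open>u\<close> in \<open>W\<close> we have \<open>b z u = b w u\<close>, which by Cauchy-Schwarz is at most \<open>\<parallel>w\<parallel> \<parallel>u\<parallel>\<close>, with
  equality at \<open>u = w\<close>. So the smallest angle is attained at the projection \<open>w\<close>, or, if \<open>w = 0\<close>,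
  at every vector, all angles being right.
\<close>

lemma angle_to_subspace:
  assumes "z \<in> E" "z \<noteq> 0" "W \<subseteq> E" "W \<noteq> {0}" "W \<noteq> {}" "w \<in> W" "\<And>u. u \<in> W \<Longrightarrow> b (z - w) u = 0"
  shows "angle_to b z W = arccos (sqrt (b w w / b z z))"
    and "b w w \<le> b z z"
proof -
  have E: "u \<in> E" if "u \<in> W" for u
    using assms(3) that by blast
  have bzu: "b z u = b w u" if "u \<in> W" for u
    using assms(7)[OF that] E[OF that] E[OF assms(6)] assms(1) by (simp add: diff_left)
  have z: "b z z > 0" using assms(1,2) by (rule pos)
  have "(b w w)\<^sup>2 \<le> b z z * b w w"
    using Cauchy_Schwarz[OF assms(1) E[OF assms(6)]] bzu[OF assms(6)] by simp
  then show le: "b w w \<le> b z z"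
    using nonneg[OF E[OF assms(6)]] z by (cases "b w w = 0") (auto simp: power2_eq_square)
  define r where "r = sqrt (b w w / b z z)"
  have r: "\<bar>r\<bar> \<le> 1"
    using le z nonneg[OF E[OF assms(6)]] by (simp add: r_def)
  have bound: "arccos r \<le> vec_angle b z u" if u: "u \<in> W - {0}" for u
  proof -
    have u': "u \<in> E" "b u u > 0" using u E pos by auto
    let ?c = "b z u / (sqrt (b z z) * sqrt (b u u))"
    have "\<bar>?c\<bar> \<le> 1"
      using Cauchy_Schwarz_sqrt[OF assms(1) u'(1)] z u'(2) by (simp add: field_simps abs_mult)
    moreover have "?c \<le> r"
    proof -
      have "b z u \<le> sqrt (b w w) * sqrt (b u u)"
        using Cauchy_Schwarz_sqrt[OF E[OF assms(6)] u'(1)] bzu[of u] u by simp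
      then show ?thesis
        using z u'(2) by (simp add: r_def real_sqrt_divide field_simps)
    qed
    ultimately show ?thesis
      unfolding vec_angle_def using r by (simp add: arccos_le_mono)
  qed
  have "\<exists>u\<in>W - {0}. vec_angle b z u = arccos r"
  proof (cases "w = 0")
    case True
    obtain u where "u \<in> W - {0}" using assms(4,5) by blast
    moreover from this have "vec_angle b z u = arccos r"
      using bzu[of u] E True by (simp add: vec_angle_def r_def)
    ultimately show ?thesis by blast
  next
    case False
    then have "b w w > 0" using E[OF assms(6)] pos by blast
    then have "b w w / (sqrt (b z z) * sqrt (b w w)) = r"
      using z by (simp add: r_def real_sqrt_divide field_simps)
    then have "vec_angle b z w = arccos r"
      by (simp add: vec_angle_def bzu[OF assms(6)])
    with False assms(6) show ?thesis by blast
  qed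
  then obtain u where "u \<in> W - {0}" "vec_angle b z u = arccos r" by blast
  then show "angle_to b z W = arccos (sqrt (b w w / b z z))"
    unfolding angle_to_def r_def[symmetric]
    by (intro cInf_eq_minimum) (use bound in \<open>auto intro: image_eqI[of _ _ u]\<close>)
qed

end

section \<open>Metallic structures on a single tangent space\<close>

text \<open>
  The situation at one point of the submanifold: \<open>E\<close> is the ambient tangent space, \<open>V\<close> the tangent space
  of the submanifold, \<open>D\<close> the differential, and \<open>D (t v)\<close> the orthogonal projection of \<open>J (D v)\<close>
  to \<open>D ` V\<close>.
\<close>

locale metallic_subspace = inner_product_on E b
  for E :: "'v::real_vector set" and b +
  fixes V :: "'w::real_vector set" and D :: "'w \<Rightarrow> 'v" and J :: "'v \<Rightarrow> 'v" and t :: "'w \<Rightarrow> 'w"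
    and p q :: real
  assumes V: "subspace V" and D: "linear D" and inj: "inj_on D V" and DE: "v \<in> V \<Longrightarrow> D v \<in> E"
    and JE: "z \<in> E \<Longrightarrow> J z \<in> E"
    and J_linear: "y \<in> E \<Longrightarrow> z \<in> E \<Longrightarrow> J (r *\<^sub>R y + s *\<^sub>R z) = r *\<^sub>R J y + s *\<^sub>R J z"
    and J_self_adjoint: "y \<in> E \<Longrightarrow> z \<in> E \<Longrightarrow> b (J y) z = b y (J z)"
    and J_metallic: "z \<in> E \<Longrightarrow> J (J z) = p *\<^sub>R J z + q *\<^sub>R z"
    and q: "q \<noteq> 0"
    and tV: "v \<in> V \<Longrightarrow> t v \<in> V"
    and t: "v \<in> V \<Longrightarrow> u \<in> V \<Longrightarrow> b (J (D v) - D (t v)) (D u) = 0"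
begin

lemma J_0 [simp]: "J 0 = 0"
  using J_linear[of 0 0 0 0] by simp

lemma J_nonzero: "z \<in> E \<Longrightarrow> z \<noteq> 0 \<Longrightarrow> J z \<noteq> 0"
  using J_metallic[of z] q by auto

lemma D_nonzero: "v \<in> V \<Longrightarrow> v \<noteq> 0 \<Longrightarrow> D v \<noteq> 0"
  using inj_onD[OF inj, of v 0] linear_0[OF D] subspace_0[OF V] by auto

lemma t_eq: "v \<in> V \<Longrightarrow> u \<in> V \<Longrightarrow> b (D (t v)) (D u) = b (J (D v)) (D u)"
  using t[of v u] by (simp add: diff_left DE JE tV)

lemma t_self_adjoint: "v \<in> V \<Longrightarrow> u \<in> V \<Longrightarrow> b (D (t v)) (D u) = b (D v) (D (t u))"
  by (metis t_eq J_self_adjoint sym DE JE tV)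

lemma tangent_eqI:
  assumes "v \<in> V" "w \<in> V" "\<And>u. u \<in> V \<Longrightarrow> b (D v) (D u) = b (D w) (D u)"
  shows "v = w"
proof -
  have d: "v - w \<in> V" using assms V by (simp add: subspace_diff)
  then have "b (D (v - w)) (D (v - w)) = 0"
    using assms(3)[OF d] assms(1,2) DE[OF d] by (simp add: linear_diff[OF D] diff_left DE)
  then show ?thesis
    using eq_zero[OF DE[OF d]] D_nonzero[OF d] by auto
qed

lemma t_add:
  assumes "v \<in> V" "w \<in> V"
  shows "t (v + w) = t v + t w"
proof (rule tangent_eqI)
  show "t (v + w) \<in> V" "t v + t w \<in> V"
    using assms V by (simp_all add: tV subspace_add)
  fix u assume u: "u \<in> V"
  have "J (D (v + w)) = J (D v) + J (D w)"
    using J_linear[OF DE DE, OF assms, of 1 1] by (simp add: linear_add[OF D])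
  then show "b (D (t (v + w))) (D u) = b (D (t v + t w)) (D u)"
    using assms u V by (simp add: t_eq linear_add[OF D] add_left DE JE tV subspace_add)
qed

text \<open>
  The right-hand equation compares two quadratic forms in \<open>v\<close>. Their bilinear forms are
  \<open>b (D (t (t v))) (D u)\<close> and \<open>l * b (J (J (D v))) (D u)\<close>, and the metallic equation replaces the
  latter's \<open>J (J (D v))\<close> by \<open>p J (D v) + q D v\<close>, whose tangential part is \<open>p t v + q v\<close>.
\<close>

lemma t_square_iff:
  "(\<forall>v\<in>V. t (t v) = l *\<^sub>R (p *\<^sub>R t v + q *\<^sub>R v)) \<longleftrightarrow>
   (\<forall>v\<in>V. b (D (t v)) (D (t v)) = l * b (J (D v)) (J (D v)))" (is "?L \<longleftrightarrow> ?R")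
proof -
  have J: "b (J (D v)) (J (D u)) = b (D (p *\<^sub>R t v + q *\<^sub>R v)) (D u)" if "v \<in> V" "u \<in> V" for v u
  proof -
    have "b (J (D v)) (J (D u)) = b (J (J (D v))) (D u)"
      using that by (simp add: J_self_adjoint DE JE)
    also have "\<dots> = b (p *\<^sub>R J (D v) + q *\<^sub>R D v) (D u)"
      using that by (simp add: J_metallic DE)
    also have "\<dots> = b (D (p *\<^sub>R t v + q *\<^sub>R v)) (D u)"
      using that V by (simp add: linear_left linear_add[OF D] linear_scale[OF D] DE JE tV t_eq)
    finally show ?thesis .
  qed
  have V': "p *\<^sub>R t v + q *\<^sub>R v \<in> V" if "v \<in> V" for v
    using that V by (simp add: tV subspace_add subspace_scale)
  show ?thesis
  proof
    assume ?L
    show ?R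
    proof
      fix v assume v: "v \<in> V"
      have "b (D (t v)) (D (t v)) = b (D (t (t v))) (D v)"
        using t_self_adjoint[OF tV[OF v] v] by simp
      also have "\<dots> = l * b (D (p *\<^sub>R t v + q *\<^sub>R v)) (D v)"
        using \<open>?L\<close> v V' by (simp add: linear_scale[OF D] scale_left DE)
      finally show "b (D (t v)) (D (t v)) = l * b (J (D v)) (J (D v))"
        using J[OF v v] by simp
    qed
  next
    assume R: ?R
    show ?L
    proof
      fix v assume v: "v \<in> V"
      show "t (t v) = l *\<^sub>R (p *\<^sub>R t v + q *\<^sub>R v)"
      proof (rule tangent_eqI)
        show "t (t v) \<in> V" "l *\<^sub>R (p *\<^sub>R t v + q *\<^sub>R v) \<in> V"
          using v V V' by (simp_all add: tV subspace_scale)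
        fix u assume u: "u \<in> V"
        \<comment> \<open>Polarization: expand the hypothesis at \<open>v + u\<close> and subtract it at \<open>v\<close> and \<open>u\<close>.\<close>
        have "J (D (v + u)) = J (D v) + J (D u)"
          using J_linear[OF DE DE, OF v u, of 1 1] by (simp add: linear_add[OF D])
        moreover have "b (D (t (v + u))) (D (t (v + u))) = l * b (J (D (v + u))) (J (D (v + u)))"
          using R u v V subspace_add by blast
        ultimately have "b (D (t v)) (D (t u)) = l * b (J (D v)) (J (D u))"
          using bspec[OF R v] bspec[OF R u] u v sym[OF DE DE, OF tV tV, OF v u] sym[OF JE JE, OF DE DE, OF v u]
          by (simp add: t_add linear_add[OF D] add_left add_right DE JE tV algebra_simps)
        then show "b (D (t (t v))) (D u) = b (D (l *\<^sub>R (p *\<^sub>R t v + q *\<^sub>R v))) (D u)"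
          using u v V' by (simp add: t_self_adjoint[OF tV] J linear_scale[OF D] scale_left DE)
      qed
    qed
  qed
qed

lemma angle_to_tangent_space:
  assumes "v \<in> V" "v \<noteq> 0"
  defines "r \<equiv> sqrt (b (D (t v)) (D (t v)) / b (J (D v)) (J (D v)))"
  shows "angle_to b (J (D v)) (D ` V) = arccos r" "0 \<le> r" "r \<le> 1" "b (J (D v)) (J (D v)) > 0"
proof -
  have nz: "J (D v) \<noteq> 0"
    using assms by (simp add: J_nonzero D_nonzero DE)
  then show p: "b (J (D v)) (J (D v)) > 0"
    using assms by (simp add: pos DE JE)
  have W: "D ` V \<subseteq> E" "D ` V \<noteq> {0}" "D ` V \<noteq> {}" "D (t v) \<in> D ` V"
    using DE D_nonzero[OF assms(1,2)] assms(1) tV by auto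
  note a = angle_to_subspace[OF JE[OF DE[OF assms(1)]] nz W]
  show "angle_to b (J (D v)) (D ` V) = arccos r"
    unfolding r_def using t assms(1) by (intro a) auto
  have "b (D (t v)) (D (t v)) \<le> b (J (D v)) (J (D v))"
    using t assms(1) by (intro a) auto
  then show "r \<le> 1" using p by (simp add: r_def)
  show "0 \<le> r" using p nonneg[OF DE[OF tV[OF assms(1)]]] by (simp add: r_def)
qed

end

section \<open>Slant submanifolds\<close>

lemma riemannian_metric_inner_product:
  assumes "smooth_manifold B" "riemannian_metric B g" "y \<in> carrier B"
  shows "inner_product_on (tangent_space B y) (g y)"
  using assms subspace_tangent_space[OF assms(1,3)]
  by unfold_locales (auto simp: riemannian_metric_def)

text \<open>
  The definite description in \<open>tangential\<close> denotes: a projection to the image of the differential exists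
  because the image is spanned by finitely many vectors, and it has only one preimage
  because the differential is injective.
\<close>

lemma tangential_is_projection:
  assumes "smooth_manifold A" "smooth_manifold B" "isometric_immersion A h B g f" "riemannian_metric B g"
    and x: "x \<in> carrier A" and z: "z \<in> tangent_space B (f x)"
  shows "tangential A B g f x z \<in> tangent_space A x"
    and "u \<in> tangent_space A x \<Longrightarrow>
      g (f x) (z - differential A B f x (tangential A B g f x z)) (differential A B f x u) = 0"
proof -
  interpret E: inner_product_on "tangent_space B (f x)" "g (f x)"
    using assms by (intro riemannian_metric_inner_product)
      (auto simp: isometric_immersion_def immersion_def smooth_map_def)
  let ?D = "differential A B f x" and ?V = "tangent_space A x"
  have sm: "smooth_map A B f" and inj: "inj_on ?D ?V"
    using assms(3) x by (auto simp: isometric_immersion_def immersion_def)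
  have lin: "linear ?D" and DE: "?D v \<in> tangent_space B (f x)" for v
    using linear_differential[OF assms(1,2) sm x] differential_tangent[OF assms(1,2) sm x] by auto
  obtain c where c: "c \<in> charts_at A x"
    using some_chart_at[OF x] ..
  have lin': "linear (?D \<circ> coord_vector A c x)"
    using linear_compose[OF linear_coord_vector[OF assms(1) c] lin] .
  have span: "span ((?D \<circ> coord_vector A c x) ` Basis) = ?D ` ?V"
    by (simp only: linear_span_image[OF lin'] span_Basis tangent_space_eq_range[OF assms(1) c] image_comp)
  have "\<exists>w\<in>?D ` ?V. \<forall>u\<in>?D ` ?V. g (f x) (z - w) u = 0"
    unfolding span[symmetric]
    by (rule E.orthogonal_projection_exists) (use z DE in auto)
  then obtain w where w: "w \<in> ?V" "\<And>u. u \<in> ?V \<Longrightarrow> g (f x) (z - ?D w) (?D u) = 0"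
    by blast
  have unique: "w' = w" if w': "w' \<in> ?V" "\<And>u. u \<in> ?V \<Longrightarrow> g (f x) (z - ?D w') (?D u) = 0" for w'
  proof -
    have d: "w' - w \<in> ?V"
      using w(1) w'(1) subspace_tangent_space[OF assms(1) x] by (simp add: subspace_diff)
    have "g (f x) (?D (w' - w)) (?D (w' - w)) =
        g (f x) (z - ?D w) (?D (w' - w)) - g (f x) (z - ?D w') (?D (w' - w))"
      using z DE by (simp add: linear_diff[OF lin] E.diff_left)
    then have "?D (w' - w) = 0"
      using w(2)[OF d] w'(2)[OF d] DE by (intro E.eq_zero) auto
    then have "?D w' = ?D w"
      by (simp add: linear_diff[OF lin])
    then show ?thesis
      using inj w(1) w'(1) by (simp add: inj_on_eq_iff)
  qed
  have "tangential A B g f x z = w"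
    unfolding tangential_def
  proof (rule the_equality)
    show "w \<in> ?V \<and> (\<forall>u\<in>?V. g (f x) (z - ?D w) (?D u) = 0)"
      using w by blast
    show "w' = w" if "w' \<in> ?V \<and> (\<forall>u\<in>?V. g (f x) (z - ?D w') (?D u) = 0)" for w'
      using that by (intro unique) blast+
  qed
  then show "tangential A B g f x z \<in> ?V"
    and "u \<in> ?V \<Longrightarrow> g (f x) (z - ?D (tangential A B g f x z)) (?D u) = 0"
    using w by simp_all
qed

text \<open>
  The hypothesis on \<open>J\<close> concerns smooth vector fields; extending \<open>u\<close> and \<open>v\<close> to such fields yields it for
  vectors.
\<close>

lemma metallic_self_adjoint:
  assumes "metallic_riemannian B J g p q" "y \<in> carrier B" "u \<in> tangent_space B y" "v \<in> tangent_space B y"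
  shows "g y (J y u) v = g y u (J y v)"
proof -
  have B: "smooth_manifold B"
    using assms(1) by (simp add: metallic_riemannian_def)
  obtain X Y where "X \<in> vector_fields B" "X y = u" "Y \<in> vector_fields B" "Y y = v"
    using tangent_vector_extends[OF B assms(2,3)] tangent_vector_extends[OF B assms(2,4)] by metis
  with assms(1,2) show ?thesis
    unfolding metallic_riemannian_def by blast
qed

definition tangential_J ::
    "('m, 'e::euclidean_space) chart set \<Rightarrow> ('n, 'f::euclidean_space) chart set
      \<Rightarrow> ('n \<Rightarrow> ('n, 'f) tangent \<Rightarrow> ('n, 'f) tangent)
      \<Rightarrow> ('n \<Rightarrow> ('n, 'f) tangent \<Rightarrow> ('n, 'f) tangent \<Rightarrow> real) \<Rightarrow> ('m \<Rightarrow> 'n)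
      \<Rightarrow> 'm \<Rightarrow> ('m, 'e) tangent \<Rightarrow> ('m, 'e) tangent"
  where "tangential_J A B J g f x v = tangential A B g f x (J (f x) (differential A B f x v))"

lemma metallic_subspace_at_point:
  assumes "metallic_riemannian B J g p q" "smooth_manifold A" "isometric_immersion A h B g f" "x \<in> carrier A"
  shows "metallic_subspace (tangent_space B (f x)) (g (f x)) (tangent_space A x)
    (differential A B f x) (J (f x)) (tangential_J A B J g f x) (real p) (real q)"
proof -
  have B: "smooth_manifold B" "riemannian_metric B g" "endomorphism_field B J" "q > 0"
    using assms(1) by (auto simp: metallic_riemannian_def)
  have sm: "smooth_map A B f" and inj: "inj_on (differential A B f x) (tangent_space A x)"
    using assms(3,4) by (auto simp: isometric_immersion_def immersion_def)
  have fx: "f x \<in> carrier B"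
    using sm assms(4) by (auto simp: smooth_map_def)
  have JE: "J (f x) z \<in> tangent_space B (f x)" if "z \<in> tangent_space B (f x)" for z
    using that B(3) fx unfolding endomorphism_field_def by blast
  note D = linear_differential[OF assms(2) B(1) sm assms(4)] differential_tangent[OF assms(2) B(1) sm assms(4)]
  interpret E: inner_product_on "tangent_space B (f x)" "g (f x)"
    using riemannian_metric_inner_product[OF B(1,2) fx] .
  show ?thesis
  proof (rule metallic_subspace.intro[OF E.inner_product_on_axioms], rule metallic_subspace_axioms.intro)
    show "subspace (tangent_space A x)" "linear (differential A B f x)"
      using D(1) subspace_tangent_space[OF assms(2,4)] by auto
    show "inj_on (differential A B f x) (tangent_space A x)" by (rule inj)
    show "differential A B f x v \<in> tangent_space B (f x)" for v by (rule D(2))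
    show "J (f x) z \<in> tangent_space B (f x)" if "z \<in> tangent_space B (f x)" for z
      using that by (rule JE)
    show "J (f x) (r *\<^sub>R y + s *\<^sub>R z) = r *\<^sub>R J (f x) y + s *\<^sub>R J (f x) z"
      if "y \<in> tangent_space B (f x)" "z \<in> tangent_space B (f x)" for y z r s
      using that B(3) fx unfolding endomorphism_field_def by blast
    show "g (f x) (J (f x) y) z = g (f x) y (J (f x) z)"
      if "y \<in> tangent_space B (f x)" "z \<in> tangent_space B (f x)" for y z
      using metallic_self_adjoint[OF assms(1) fx that] .
    show "J (f x) (J (f x) z) = real p *\<^sub>R J (f x) z + real q *\<^sub>R z" if "z \<in> tangent_space B (f x)" for z
      using that assms(1) fx unfolding metallic_riemannian_def by blast
    show "real q \<noteq> 0" using B(4) by simp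
    show "tangential_J A B J g f x v \<in> tangent_space A x" for v
      unfolding tangential_J_def
      by (rule tangential_is_projection(1)[OF assms(2) B(1) assms(3) B(2) assms(4) JE[OF D(2)]])
    show "g (f x) (J (f x) (differential A B f x v) - differential A B f x (tangential_J A B J g f x v))
        (differential A B f x u) = 0" if "u \<in> tangent_space A x" for u v
      unfolding tangential_J_def
      by (rule tangential_is_projection(2)[OF assms(2) B(1) assms(3) B(2) assms(4) JE[OF D(2)] that])
  qed
qed

lemma scaleR_fun_apply: "(r *\<^sub>R F) x = r *\<^sub>R F x"
  by (simp add: scaleR_fun_def)

text \<open>
  On the carrier \<open>T_op\<close> depends only on the value of the field at the point, and every tangent
  vector is such a value. Off the carrier both sides of the equation between fields are zero.
\<close>

lemma T_op_square_iff_pointwise: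
  assumes "metallic_riemannian B J g p q" "smooth_manifold A" "isometric_immersion A h B g f"
  shows "(\<forall>X\<in>vector_fields A.
      T_op A B J g f (T_op A B J g f X) = l *\<^sub>R (real p *\<^sub>R T_op A B J g f X + real q *\<^sub>R X)) \<longleftrightarrow>
    (\<forall>x\<in>carrier A. \<forall>v\<in>tangent_space A x.
      tangential_J A B J g f x (tangential_J A B J g f x v) =
      l *\<^sub>R (real p *\<^sub>R tangential_J A B J g f x v + real q *\<^sub>R v))" (is "?L \<longleftrightarrow> ?R")
proof
  have T: "T_op A B J g f X x = tangential_J A B J g f x (X x)" if "x \<in> carrier A" for X x
    using that by (simp add: T_op_def tangential_J_def)
  show ?R if ?L
  proof (intro ballI)
    fix x v assume x: "x \<in> carrier A" and v: "v \<in> tangent_space A x"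
    obtain X where X: "X \<in> vector_fields A" "X x = v"
      using tangent_vector_extends[OF assms(2) x v] .
    from fun_cong[OF bspec[OF that X(1)], of x] show
      "tangential_J A B J g f x (tangential_J A B J g f x v) =
      l *\<^sub>R (real p *\<^sub>R tangential_J A B J g f x v + real q *\<^sub>R v)"
      using x X(2) by (simp add: T scaleR_fun_apply)
  qed
  show ?L if R: ?R
  proof (rule ballI, rule ext)
    fix X x assume X: "X \<in> vector_fields A"
    then have Xx: "X x \<in> tangent_space A x"
      by (simp add: vector_fields_def)
    show "T_op A B J g f (T_op A B J g f X) x = (l *\<^sub>R (real p *\<^sub>R T_op A B J g f X + real q *\<^sub>R X)) x"
    proof (cases "x \<in> carrier A")
      case True
      then show ?thesis using R Xx by (simp add: T scaleR_fun_apply)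
    next
      case False
      then show ?thesis using tangent_space_outside[OF False Xx] by (simp add: T_op_def scaleR_fun_apply)
    qed
  qed
qed

text \<open>
  The constants correspond by \<open>l = cos\<^sup>2 \<theta>\<close> and \<open>\<theta> = arccos (sqrt l)\<close>. For \<open>v = 0\<close>,
  where there is no angle, both norms vanish.
\<close>

lemma slant_iff_norm_ratio:
  assumes "metallic_riemannian B J g p q" "smooth_manifold A" "isometric_immersion A h B g f"
  shows "slant A B J g f \<longleftrightarrow> (\<exists>l\<in>{0..1}. \<forall>x\<in>carrier A. \<forall>v\<in>tangent_space A x.
    g (f x) (differential A B f x (tangential_J A B J g f x v)) (differential A B f x (tangential_J A B J g f x v)) =
    l * g (f x) (J (f x) (differential A B f x v)) (J (f x) (differential A B f x v)))"
    (is "_ \<longleftrightarrow> (\<exists>l\<in>_. \<forall>x\<in>_. \<forall>v\<in>_. ?t x v = l * ?J x v)")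
proof
  note loc = metallic_subspace_at_point[OF assms]
  note angle = metallic_subspace.angle_to_tangent_space[OF loc]
  show "slant A B J g f" if "\<exists>l\<in>{0..1}. \<forall>x\<in>carrier A. \<forall>v\<in>tangent_space A x. ?t x v = l * ?J x v"
  proof -
    obtain l where l: "l \<in> {0..1}" "\<And>x v. x \<in> carrier A \<Longrightarrow> v \<in> tangent_space A x \<Longrightarrow> ?t x v = l * ?J x v"
      using \<open>\<exists>l\<in>_. _\<close> by blast
    have "arccos (sqrt l) \<in> {0..pi / 2}"
      using l(1) arccos_lbound[of "sqrt l"] arccos_le_pi2[of "sqrt l"]
        order_trans[OF _ real_sqrt_ge_zero, of "- 1" l] by simp
    moreover have "angle_to (g (f x)) (J (f x) (differential A B f x v))
        (differential A B f x ` tangent_space A x) = arccos (sqrt l)"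
      if x: "x \<in> carrier A" and v: "v \<in> tangent_space A x" "v \<noteq> 0" for x v
      using angle(1,4)[OF x v] l(2)[OF x v(1)] by simp
    ultimately show ?thesis
      unfolding slant_def by blast
  qed
  show "\<exists>l\<in>{0..1}. \<forall>x\<in>carrier A. \<forall>v\<in>tangent_space A x. ?t x v = l * ?J x v" if slant: "slant A B J g f"
  proof -
    obtain \<theta> where "\<forall>x\<in>carrier A. \<forall>v\<in>tangent_space A x. v \<noteq> 0 \<longrightarrow>
        angle_to (g (f x)) (J (f x) (differential A B f x v)) (differential A B f x ` tangent_space A x) = \<theta>"
      using slant unfolding slant_def by (elim bexE)
    note \<theta> = this[rule_format]
    have "?t x v = (cos \<theta>)\<^sup>2 * ?J x v" if x: "x \<in> carrier A" and v: "v \<in> tangent_space A x" for x v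
    proof (cases "v = 0")
      case True
      interpret metallic_subspace "tangent_space B (f x)" "g (f x)" "tangent_space A x"
        "differential A B f x" "J (f x)" "tangential_J A B J g f x" "real p" "real q"
        by (rule loc[OF x])
      show ?thesis
        using t_eq[OF v tV[OF v]] DE[OF tV[OF v]] True by (simp add: linear_0[OF D])
    next
      case False
      define r where "r = sqrt (?t x v / ?J x v)"
      have r: "arccos r = \<theta>" "0 \<le> r" "r \<le> 1" "?J x v > 0"
        using angle[OF x v False] \<theta>[OF x v False] by (simp_all add: r_def)
      then have "cos \<theta> = r"
        by (metis cos_arccos order_trans neg_le_0_iff_le zero_le_one)
      moreover have "r\<^sup>2 = ?t x v / ?J x v"
        using r(2) by (simp add: r_def)
      ultimately show ?thesis using r(4) by simp
    qed
    moreover have "(cos \<theta>)\<^sup>2 \<in> {0..1}"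
      by (simp add: abs_square_le_1)
    ultimately show ?thesis by blast
  qed
qed

theorem proposition3p22:
  fixes B :: "('n::{t2_space, second_countable_topology}, 'f::euclidean_space) chart set"
    and J :: "'n \<Rightarrow> ('n, 'f) tangent \<Rightarrow> ('n, 'f) tangent"
    and g :: "'n \<Rightarrow> ('n, 'f) tangent \<Rightarrow> ('n, 'f) tangent \<Rightarrow> real"
    and p q :: nat
    and A :: "('m::{t2_space, second_countable_topology}, 'e::euclidean_space) chart set"
    and h :: "'m \<Rightarrow> ('m, 'e) tangent \<Rightarrow> ('m, 'e) tangent \<Rightarrow> real"
    and f :: "'m \<Rightarrow> 'n"
  assumes "metallic_riemannian B J g p q"
    and "smooth_manifold A" and "riemannian_metric A h"
    and "isometric_immersion A h B g f"
  shows "slant A B J g f \<longleftrightarrow>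
    (\<exists>l\<in>{0..1::real}. \<forall>X\<in>vector_fields A.
       T_op A B J g f (T_op A B J g f X) = l *\<^sub>R (real p *\<^sub>R T_op A B J g f X + real q *\<^sub>R X))"
  unfolding slant_iff_norm_ratio[OF assms(1,2,4)] T_op_square_iff_pointwise[OF assms(1,2,4)]
  by (intro bex_cong ball_cong refl
      metallic_subspace.t_square_iff[OF metallic_subspace_at_point[OF assms(1,2,4)], symmetric])

end
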